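(* Let $n\in\mathbb N$, $a(t)=(t-2+\frac1t)^3$, $g(\varphi)=a(e^{i\varphi})=-\left(2\sin\frac{\varphi}{2}\right)^6$, and let $\varphi\in(0,\pi)$, $\lambda=g(\varphi)$. Then the equation $\det T_n(a-g(\varphi))=0$ holds if and only if $\varphi$ satisfies at least one of the two equations $$\tan\left(\frac{n+3}{2}\varphi\right)=f(\varphi)$$ and $$\tan\left(\frac{n+3}{2}\varphi\right)=\frac{1}{h(\varphi)},$$ where $$f(\varphi)=2\,\frac{B(\varphi)\sin((n+3)c(\varphi))+C(\varphi)\sinh((n+3)b(\varphi))}{\sin(\varphi)\,\bigl(\cos((n+3)c(\varphi))+\cosh((n+3)b(\varphi))\bigr)},$$ $$h(\varphi)=2\,\frac{B(\varphi)\sin((n+3)c(\varphi))-C(\varphi)\sinh((n+3)b(\varphi))}{\sin(\varphi)\,\bigl(-\cos((n+3)c(\varphi))+\cosh((n+3)b(\varphi))\bigr)}.$$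
   Context: For a function $p$ on the unit circle with Fourier coefficients $p_l$, $T_n(p)=(p_{j-k})_{j,k=0}^{n-1}$ is the $n\times n$ Toeplitz matrix with symbol $p$; $a-g(\varphi)$ is the symbol $t\mapsto a(t)-g(\varphi)$. $\beta:[0,\pi]\to\mathbb C$ is the regular branch of $\arccos\bigl(1-(1-\cos\varphi)e^{2\pi i/3}\bigr)$ determined as follows: $\beta$ is continuous, $\beta(0)=0$, $\cos\beta(\varphi)=1-(1-\cos\varphi)e^{2\pi i/3}$, and for $\varphi\in(0,\pi)$ one has $\sin\beta(\varphi)=B_s(\varphi)e^{i\psi_s(\varphi)}$ with $B_s(\varphi)>0$ and $\psi_s(\varphi)\in(\frac{\pi}{4},\frac{\pi}{3})$. For $\varphi\in(0,\pi)$ put $c(\varphi)=\Re\beta(\varphi)$, $b(\varphi)=\Im\beta(\varphi)$, $B(\varphi)=\Re\bigl(\sin(\beta(\varphi))e^{-\pi i/3}\bigr)$, $C(\varphi)=-\Im\bigl(\sin(\beta(\varphi))e^{-\pi i/3}\bigr)$. Convention: in the equation $\tan(\frac{n+3}{2}\varphi)=1/h(\varphi)$, a point where $h(\varphi)=0$ and $\cos(\frac{n+3}{2}\varphi)=0$ (both sides infinite) is regarded as a solution, i.e. the equation means $\cos(\frac{n+3}{2}\varphi)=h(\varphi)\sin(\frac{n+3}{2}\varphi)$. *)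

theory Defs
  imports "HOL-Analysis.Analysis" "Jordan_Normal_Form.Determinant"
begin

text \<open>The function \<open>p\<close> on the unit circle is represented by a function on the complex plane, of
  which only the values at \<open>cis \<theta>\<close> are used.\<close>

definition fourier_coeff :: "(complex \<Rightarrow> complex) \<Rightarrow> int \<Rightarrow> complex" where
  "fourier_coeff p l =
     integral {0..2 * pi} (\<lambda>\<theta>. p (cis \<theta>) * cis (- of_int l * \<theta>)) / of_real (2 * pi)"

definition toeplitz :: "nat \<Rightarrow> (complex \<Rightarrow> complex) \<Rightarrow> complex mat" where
  "toeplitz n p = mat n n (\<lambda>(j, k). fourier_coeff p (int j - int k))"

definition a_symbol :: "complex \<Rightarrow> complex" where
  "a_symbol t = (t - 2 + 1 / t) ^ 3"

definition g :: "real \<Rightarrow> complex" where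
  "g \<phi> = a_symbol (cis \<phi>)"

lemma g_eq: "g \<phi> = of_real (- ((2 * sin (\<phi> / 2)) ^ 6))"
proof -
  have "cis \<phi> - 2 + 1 / cis \<phi> = of_real (2 * cos (2 * (\<phi> / 2)) - 2)"
    by (subst divide_inverse, subst cis_inverse) (simp add: complex_eq_iff)
  also have "\<dots> = of_real (- ((2 * sin (\<phi> / 2)) ^ 2))"
    unfolding cos_double_sin by (simp add: power2_eq_square)
  finally show ?thesis
    unfolding g_def a_symbol_def by (simp only: flip: of_real_power) (simp add: power_mult_distrib)
qed

text \<open>These conditions determine \<open>\<beta>\<close> uniquely on \<open>[0, \<pi>]\<close>; values outside are irrelevant.\<close>

definition is_beta_branch :: "(real \<Rightarrow> complex) \<Rightarrow> bool" where
  "is_beta_branch \<beta> \<longleftrightarrow>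
     continuous_on {0..pi} \<beta> \<and> \<beta> 0 = 0 \<and>
     (\<forall>\<phi>\<in>{0..pi}. cos (\<beta> \<phi>) = 1 - (1 - of_real (cos \<phi>)) * exp (2 * of_real pi * \<i> / 3)) \<and>
     (\<forall>\<phi>\<in>{0<..<pi}. \<exists>B\<^sub>s \<psi>\<^sub>s. B\<^sub>s > 0 \<and> \<psi>\<^sub>s \<in> {pi / 4<..<pi / 3} \<and>
        sin (\<beta> \<phi>) = of_real B\<^sub>s * exp (\<i> * of_real \<psi>\<^sub>s))"

definition c_fun :: "(real \<Rightarrow> complex) \<Rightarrow> real \<Rightarrow> real" where
  "c_fun \<beta> \<phi> = Re (\<beta> \<phi>)"

definition b_fun :: "(real \<Rightarrow> complex) \<Rightarrow> real \<Rightarrow> real" where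
  "b_fun \<beta> \<phi> = Im (\<beta> \<phi>)"

definition B_fun :: "(real \<Rightarrow> complex) \<Rightarrow> real \<Rightarrow> real" where
  "B_fun \<beta> \<phi> = Re (sin (\<beta> \<phi>) * exp (- (of_real pi * \<i> / 3)))"

definition C_fun :: "(real \<Rightarrow> complex) \<Rightarrow> real \<Rightarrow> real" where
  "C_fun \<beta> \<phi> = - Im (sin (\<beta> \<phi>) * exp (- (of_real pi * \<i> / 3)))"

definition f_fun :: "(real \<Rightarrow> complex) \<Rightarrow> nat \<Rightarrow> real \<Rightarrow> real" where
  "f_fun \<beta> n \<phi> =
     2 * ((B_fun \<beta> \<phi> * sin ((real n + 3) * c_fun \<beta> \<phi>) + C_fun \<beta> \<phi> * sinh ((real n + 3) * b_fun \<beta> \<phi>)) /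
          (sin \<phi> * (cos ((real n + 3) * c_fun \<beta> \<phi>) + cosh ((real n + 3) * b_fun \<beta> \<phi>))))"

definition h_fun :: "(real \<Rightarrow> complex) \<Rightarrow> nat \<Rightarrow> real \<Rightarrow> real" where
  "h_fun \<beta> n \<phi> =
     2 * ((B_fun \<beta> \<phi> * sin ((real n + 3) * c_fun \<beta> \<phi>) - C_fun \<beta> \<phi> * sinh ((real n + 3) * b_fun \<beta> \<phi>)) /
          (sin \<phi> * (- cos ((real n + 3) * c_fun \<beta> \<phi>) + cosh ((real n + 3) * b_fun \<beta> \<phi>))))"

text \<open>Since HOL's \<open>tan\<close> is \<open>0\<close> at its poles, the equation \<open>tan x = y\<close> for a finite \<open>y\<close> has to
  exclude the poles explicitly.\<close>

definition tan_eq :: "real \<Rightarrow> real \<Rightarrow> bool" where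
  "tan_eq x y \<longleftrightarrow> cos x \<noteq> 0 \<and> tan x = y"

text \<open>The equation \<open>tan x = 1 / y\<close>, where both sides being infinite (\<open>cos x = 0\<close> and
  \<open>y = 0\<close>) counts as equality.\<close>

definition tan_eq_recip :: "real \<Rightarrow> real \<Rightarrow> bool" where
  "tan_eq_recip x y \<longleftrightarrow> cos x = y * sin x"

lemma tan_eq_recip_iff:
  "tan_eq_recip x y \<longleftrightarrow> (cos x \<noteq> 0 \<and> y \<noteq> 0 \<and> tan x = 1 / y) \<or> (cos x = 0 \<and> y = 0)"
proof (cases "cos x = 0")
  case True
  then have "sin x \<noteq> 0" using sin_cos_squared_add[of x] by auto
  with True show ?thesis by (auto simp: tan_eq_recip_def)
next
  case False
  then show ?thesis by (auto simp: tan_eq_recip_def tan_def field_simps)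
qed

lemma ex_is_beta_branch: "\<exists>\<beta>. is_beta_branch \<beta>"
proof -
  define w where "w = exp (2 * of_real pi * \<i> / 3)"
  have "w = cis (2 * pi / 3)"
    by (simp add: w_def cis_conv_exp mult_ac)
  then have w: "Re w = - 1 / 2" "Im w = sqrt 3 / 2"
    using cos_120 sin_120 by (simp_all add: mult.commute)
  define z where "z = (\<lambda>\<phi>::real. 1 - (1 - of_real (cos \<phi>)) * w)"
  have Rez: "Re (z \<phi>) = 1 + (1 - cos \<phi>) / 2"
    and Imz: "Im (z \<phi>) = - ((1 - cos \<phi>) * sqrt 3 / 2)" for \<phi>
    by (simp_all add: z_def w field_simps)
  have cos_less: "cos \<phi> < 1" if "0 < \<phi>" "\<phi> \<le> pi" for \<phi>
    using cos_monotone_0_pi[of 0 \<phi>] that by simp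
  have cont_z: "continuous_on A z" for A
    unfolding z_def by (intro continuous_intros)
  have cont_csqrt_0: "isCont csqrt 0"
  proof -
    have cmod_csqrt: "norm (csqrt x) = sqrt (norm x)" for x
      by (metis norm_ge_zero norm_power power2_csqrt real_sqrt_abs abs_of_nonneg)
    have "((\<lambda>x::complex. sqrt (norm x)) \<longlongrightarrow> sqrt (norm (0::complex))) (at 0)"
      by (intro tendsto_intros)
    then have "((\<lambda>x. norm (csqrt x)) \<longlongrightarrow> 0) (at 0)"
      by (simp only: cmod_csqrt norm_zero real_sqrt_zero)
    then have "(csqrt \<longlongrightarrow> 0) (at 0)"
      by (rule tendsto_norm_zero_cancel)
    then show ?thesis by (simp add: isCont_def)
  qed
  have "isCont (\<lambda>x. csqrt (1 - x\<^sup>2)) 1"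
    by (rule isCont_o2[where g = csqrt]) (use cont_csqrt_0 in \<open>auto intro!: continuous_intros\<close>)
  then have cont_Arccos_1: "isCont Arccos 1"
    unfolding Arccos_def by (intro continuous_intros isCont_Ln') auto
  have "isCont Arccos (z \<phi>)" if "\<phi> \<in> {0..pi}" for \<phi>
  proof (cases "\<phi> = 0")
    case True
    then show ?thesis using cont_Arccos_1 by (simp add: z_def)
  next
    case False
    then have "Im (z \<phi>) \<noteq> 0" using that cos_less[of \<phi>] by (simp add: Imz)
    then show ?thesis by (intro isCont_Arccos) auto
  qed
  then have "continuous_on (z ` {0..pi}) Arccos"
    by (intro continuous_at_imp_continuous_on) auto
  then have cont: "continuous_on {0..pi} (\<lambda>\<phi>. Arccos (z \<phi>))"
    using cont_z by (rule continuous_on_compose2) auto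
  have polar: "\<exists>B\<^sub>s \<psi>\<^sub>s. B\<^sub>s > 0 \<and> \<psi>\<^sub>s \<in> {pi / 4<..<pi / 3} \<and>
      sin (Arccos (z \<phi>)) = of_real B\<^sub>s * exp (\<i> * of_real \<psi>\<^sub>s)"
    if "\<phi> \<in> {0<..<pi}" for \<phi>
  proof -
    define u where "u = 1 - cos \<phi>"
    define s where "s = sin (Arccos (z \<phi>))"
    have u: "0 < u" "u < 2"
      using that cos_less[of \<phi>] cos_monotone_0_pi[of \<phi> pi] by (auto simp: u_def)
    have Rez': "Re (z \<phi>) = 1 + u / 2" and Imz': "Im (z \<phi>) = - (u * sqrt 3 / 2)"
      unfolding Rez Imz u_def by (rule refl)+
    have "s = csqrt (1 - (z \<phi>)\<^sup>2)"
      unfolding s_def using u by (intro sin_Arccos disjI1) (simp add: Rez')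
    then have s: "s\<^sup>2 = 1 - (z \<phi>)\<^sup>2" and "Re s \<ge> 0"
      using csqrt_principal[of "1 - (z \<phi>)\<^sup>2"] by auto
    have "(Re s)\<^sup>2 - (Im s)\<^sup>2 = 1 - ((1 + u / 2)\<^sup>2 - (u * sqrt 3 / 2)\<^sup>2)"
      using arg_cong[OF s, of Re] by (simp add: Re_power2 Rez' Imz')
    moreover have "(u * sqrt 3 / 2)\<^sup>2 = 3 * u\<^sup>2 / 4"
      by (simp add: power_mult_distrib power_divide)
    ultimately have re: "(Im s)\<^sup>2 - (Re s)\<^sup>2 = u * (2 - u) / 2"
      by (simp add: power2_eq_square field_simps)
    have im: "2 * Re s * Im s = sqrt 3 * (u * (2 + u)) / 2"
      using arg_cong[OF s, of Im] by (simp add: Im_power2 Rez' Imz' field_simps)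
    moreover have "sqrt 3 * (u * (2 + u)) > 0" using u by simp
    ultimately have "Re s * Im s > 0" by linarith
    with \<open>Re s \<ge> 0\<close> have pos: "Re s > 0" "Im s > 0"
      by (auto simp: zero_less_mult_iff)
    have "(Re s)\<^sup>2 < (Im s)\<^sup>2"
      using re mult_pos_pos[of u "2 - u"] u by linarith
    then have lo: "Re s < Im s" by (rule power2_less_imp_less) (use pos in simp)
    have "2 * Re s * Im s - sqrt 3 * ((Im s)\<^sup>2 - (Re s)\<^sup>2) = sqrt 3 * u\<^sup>2"
      unfolding re im by (simp add: power2_eq_square field_simps)
    also have "\<dots> > 0" using u by simp
    finally have "2 * Re s * Im s - sqrt 3 * ((Im s)\<^sup>2 - (Re s)\<^sup>2) > 0" .
    moreover have "2 * Re s * Im s - sqrt 3 * ((Im s)\<^sup>2 - (Re s)\<^sup>2)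
        = (sqrt 3 * Im s + Re s) * (sqrt 3 * Re s - Im s)"
      by (simp add: power2_eq_square algebra_simps)
    moreover have "sqrt 3 * Im s + Re s > 0" using pos by (intro add_pos_pos) auto
    ultimately have hi: "Im s < sqrt 3 * Re s" by (simp add: zero_less_mult_iff)
    define \<psi> where "\<psi> = arctan (Im s / Re s)"
    have "1 < Im s / Re s" using lo pos by simp
    then have "\<psi> > arctan 1" unfolding \<psi>_def by (simp only: arctan_less_iff)
    moreover have "arctan (sqrt 3) = pi / 3"
      using tan_60 pi_gt_zero by (intro arctan_unique) linarith+
    moreover have "Im s / Re s < sqrt 3" using hi pos by (simp add: divide_less_eq)
    then have "\<psi> < arctan (sqrt 3)" unfolding \<psi>_def by (simp only: arctan_less_iff)
    ultimately have "\<psi> \<in> {pi / 4<..<pi / 3}" by (simp add: arctan_one)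
    moreover have cos_pos: "cos \<psi> > 0" unfolding \<psi>_def
      using arctan_lbound[of "Im s / Re s"] arctan_ubound[of "Im s / Re s"]
      by (intro cos_gt_zero_pi) auto
    have "s = of_real (Re s / cos \<psi>) * exp (\<i> * of_real \<psi>)"
    proof -
      have "tan \<psi> = Im s / Re s" by (simp add: \<psi>_def tan_arctan)
      then have "Im s * cos \<psi> = Re s * sin \<psi>" using cos_pos pos by (simp add: tan_def field_simps)
      then show ?thesis
        using cos_pos unfolding cis_conv_exp[symmetric] by (simp add: complex_eq_iff field_simps)
    qed
    moreover have "Re s / cos \<psi> > 0" using cos_pos pos by simp
    ultimately show ?thesis unfolding s_def by blast
  qed
  have "is_beta_branch (\<lambda>\<phi>. Arccos (z \<phi>))"
    unfolding is_beta_branch_def using cont polar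
    by (simp add: z_def flip: w_def)
  then show ?thesis by blast
qed

end

theory Submission
  imports Defs
begin

text \<open>
  Put \<open>\<lambda> = g \<phi>\<close> and \<open>q(t) = (t - 1)\<^sup>6 - \<lambda>t\<^sup>3\<close>, so that \<open>a(t) - \<lambda> = q(t) / t^3\<close>. A vector in the
  kernel of \<open>T\<^sub>n(a - \<lambda>)\<close> is the coefficient vector of a polynomial \<open>V\<close> of degree less than \<open>n\<close>
  for which the \<open>n\<close> middle coefficients of \<open>q V\<close> vanish, that is, \<open>q V = P + t^(n+3) Q\<close> with
  \<open>P\<close> and \<open>Q\<close> of degree at most 2. Hence the determinant vanishes iff \<open>q\<close> divides some
  nonzero \<open>P + t^(n+3) Q\<close> (\<open>det_toeplitz_eq_0_iff_dvd\<close>).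

  Since \<open>t + 1/t - 2 = 2 cos \<theta> - 2\<close> at \<open>t = exp (\<i>\<theta>)\<close>, the roots of \<open>q\<close> are the six distinct
  numbers \<open>exp (\<plusminus>\<i>\<theta>)\<close> with \<open>\<theta>\<close> one of \<open>\<theta>\<^sub>0 = \<phi>\<close>, \<open>\<theta>\<^sub>1 = \<beta>(\<phi>)\<close> and the conjugate \<open>\<theta>\<^sub>2\<close> of \<open>\<theta>\<^sub>1\<close>:
  for these angles \<open>1 - cos \<theta>\<close> is \<open>d\<close>, \<open>d\<omega>\<close>, \<open>d\<omega>\<^sup>2\<close> with \<open>d = 1 - cos \<phi>\<close> and \<open>\<omega> = exp (2\<pi>\<i>/3)\<close>.
  With \<open>M = (n + 3)/2\<close>, the quotient of \<open>P + t^(n+3) Q\<close> by \<open>t^(M+1)\<close> is at \<open>exp (\<i>\<theta>)\<close> a combination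
  of \<open>exp (\<plusminus>\<i>m\<theta>)\<close> for \<open>m = M - 1, M, M + 1\<close>. Its even and odd parts in \<open>\<theta>\<close> have independent
  coefficients, so the six linear conditions on \<open>P\<close> and \<open>Q\<close> fall apart into two systems of
  size three, one in cosines and one in sines (\<open>ex_dvd_iff_trig_dependent\<close>).

  The determinant of the cosine system is, up to a nonzero factor, the sum of
  \<open>\<omega>\<^sup>k sin \<theta>\<^sub>k tan (M\<theta>\<^sub>k)\<close> over \<open>k = 0, 1, 2\<close>, cleared of denominators; in the sine system \<open>- cot\<close>
  replaces \<open>tan\<close>. The terms with \<open>k = 1, 2\<close> are conjugate to each other, and the real
  equation that remains is the equation with \<open>f\<close>, respectively the one with \<open>1/h\<close>.
\<close>

section \<open>Singular Toeplitz matrices and polynomial divisibility\<close>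

lemma has_integral_cis_int_mult:
  fixes m :: int
  shows "((\<lambda>\<theta>. cis (of_int m * \<theta>)) has_integral (if m = 0 then of_real (2 * pi) else 0)) {0..2 * pi}"
proof (cases "m = 0")
  case True
  have "((\<lambda>\<theta>. 1 :: complex) has_integral of_real (2 * pi)) {0..2 * pi}"
    using has_integral_const_real[of "1 :: complex" 0 "2 * pi"] by (simp add: scaleR_conv_of_real)
  with True show ?thesis by simp
next
  case False
  define A where "A = (\<lambda>\<theta>::real. cis (of_int m * \<theta>) / (\<i> * of_int m))"
  have "((\<lambda>\<theta>. cis (of_int m * \<theta>)) has_integral A (2 * pi) - A 0) {0..2 * pi}"
  proof (rule fundamental_theorem_of_calculus)
    fix x :: real
    show "(A has_vector_derivative cis (of_int m * x)) (at x within {0..2 * pi})"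
      unfolding A_def has_vector_derivative_def using False
      by (auto intro!: derivative_eq_intros simp: scaleR_conv_of_real field_simps)
  qed simp
  moreover have "cis (of_int m * (2 * pi)) = 1"
    using cis_multiple_2pi[of "of_int m"] by (simp add: mult_ac)
  ultimately show ?thesis
    using False by (simp add: A_def)
qed

text \<open>A Laurent polynomial \<open>q(t) / t^r\<close> has the coefficients of \<open>q\<close>, shifted by \<open>r\<close>, as its Fourier
  coefficients, because the characters \<open>exp (\<i>m\<theta>)\<close> with \<open>m \<noteq> 0\<close> integrate to zero.\<close>

lemma fourier_coeff_eq_coeff:
  assumes p: "\<And>\<theta>. p (cis \<theta>) * cis \<theta> ^ r = poly q (cis \<theta>)"
  shows "fourier_coeff p l = (if l + int r \<ge> 0 then coeff q (nat (l + int r)) else 0)"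
proof -
  have integrand: "p (cis \<theta>) * cis (- of_int l * \<theta>) =
      (\<Sum>i\<le>degree q. coeff q i * cis (of_int (int i - (l + int r)) * \<theta>))" for \<theta>
  proof -
    have "p (cis \<theta>) = poly q (cis \<theta>) * cis (- real r * \<theta>)"
      using p[of \<theta>] by (simp add: Complex.DeMoivre cis_mult flip: p)
    then have "p (cis \<theta>) * cis (- of_int l * \<theta>) =
        (\<Sum>i\<le>degree q. coeff q i * (cis \<theta> ^ i * cis (- real r * \<theta>) * cis (- of_int l * \<theta>)))"
      by (simp add: poly_altdef sum_distrib_right mult.assoc)
    then show ?thesis
      by (simp add: Complex.DeMoivre cis_mult algebra_simps)
  qed
  have "((\<lambda>\<theta>. p (cis \<theta>) * cis (- of_int l * \<theta>)) has_integral
      (\<Sum>i\<le>degree q. coeff q i * (if int i - (l + int r) = 0 then of_real (2 * pi) else 0))) {0..2 * pi}"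
    unfolding integrand
    by (intro has_integral_sum has_integral_mult_right has_integral_cis_int_mult) auto
  also have "(\<Sum>i\<le>degree q. coeff q i * (if int i - (l + int r) = 0 then of_real (2 * pi) else 0))
      = (\<Sum>i\<le>degree q. if i = nat (l + int r) \<and> l + int r \<ge> 0 then coeff q i * of_real (2 * pi) else 0)"
    by (intro sum.cong) auto
  also have "\<dots> = (if l + int r \<ge> 0 then coeff q (nat (l + int r)) else 0) * of_real (2 * pi)"
    using coeff_eq_0[of q "nat (l + int r)"] by (auto simp: not_le)
  finally show ?thesis
    unfolding fourier_coeff_def by (simp add: integral_unique)
qed

text \<open>Multiplication by a banded Toeplitz matrix is a window of the convolution that multiplies
  polynomials.\<close>

lemma toeplitz_mult_vec_eq_coeff:
  fixes V :: "complex poly"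
  assumes p: "\<And>\<theta>. p (cis \<theta>) * cis \<theta> ^ r = poly q (cis \<theta>)"
    and V: "\<And>i. i \<ge> n \<Longrightarrow> coeff V i = 0" and j: "j < n"
  shows "(toeplitz n p *\<^sub>v Matrix.vec n (coeff V)) $ j = coeff (q * V) (j + r)"
proof -
  have "(toeplitz n p *\<^sub>v Matrix.vec n (coeff V)) $ j =
      (\<Sum>k<n. (if k \<le> j + r then coeff q (j + r - k) else 0) * coeff V k)"
  proof -
    have "fourier_coeff p (int j - int k) = (if k \<le> j + r then coeff q (j + r - k) else 0)" for k
      unfolding fourier_coeff_eq_coeff[OF p]
      by (auto intro!: arg_cong[of _ _ "coeff q"])
    then show ?thesis
      using j by (simp add: toeplitz_def scalar_prod_def lessThan_atLeast0)
  qed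
  also have "\<dots> = (\<Sum>k\<le>j + r. coeff V k * coeff q (j + r - k))"
    by (intro sum.mono_neutral_cong) (auto simp: V)
  finally show ?thesis
    by (simp add: coeff_mult mult.commute[of q])
qed

text \<open>The coefficients of \<open>q V\<close> outside the window \<open>{r..<n + r}\<close> that the matrix sees are \<open>r\<close> low
  ones, forming \<open>P\<close>, and, as \<open>q\<close> has degree \<open>2r\<close>, \<open>r\<close> high ones, forming \<open>Q\<close>. Conversely, the
  degree of \<open>q\<close> forces any quotient \<open>V\<close> of \<open>P + t^(n+r) Q\<close> to have degree less than \<open>n\<close>.\<close>

lemma det_toeplitz_eq_0_iff_dvd:
  assumes p: "\<And>\<theta>. p (cis \<theta>) * cis \<theta> ^ r = poly q (cis \<theta>)"
    and q: "q \<noteq> 0" "degree q = 2 * r"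
  shows "Determinant.det (toeplitz n p) = 0 \<longleftrightarrow>
    (\<exists>P Q. (P \<noteq> 0 \<or> Q \<noteq> 0) \<and> (\<forall>i\<ge>r. coeff P i = 0 \<and> coeff Q i = 0) \<and>
      q dvd P + monom 1 (n + r) * Q)"
proof -
  have carrier: "toeplitz n p \<in> carrier_mat n n"
    by (simp add: toeplitz_def)
  have "Determinant.det (toeplitz n p) = 0 \<longleftrightarrow>
      (\<exists>V. V \<noteq> 0 \<and> (\<forall>i\<ge>n. coeff V i = 0) \<and> (\<forall>j<n. coeff (q * V) (j + r) = 0))" (is "_ \<longleftrightarrow> ?R")
    unfolding det_0_iff_vec_prod_zero[OF carrier]
  proof safe
    fix v :: "complex Matrix.vec"
    assume v: "v \<in> carrier_vec n" "v \<noteq> 0\<^sub>v n" "toeplitz n p *\<^sub>v v = 0\<^sub>v n"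
    define V where "V = Poly (list_of_vec v)"
    have coeff_V: "coeff V i = (if i < n then v $ i else 0)" for i
      using v(1) by (auto simp: V_def nth_default_def list_of_vec_index)
    have v_eq: "v = Matrix.vec n (coeff V)"
      using v(1) by (intro eq_vecI) (auto simp: coeff_V)
    show ?R
    proof (intro exI[of _ V] conjI allI impI)
      show "V \<noteq> 0" using v(2) v_eq by (auto simp: zero_vec_def)
      fix j assume j: "j < n"
      have "coeff (q * V) (j + r) = (toeplitz n p *\<^sub>v v) $ j"
        unfolding v_eq by (intro toeplitz_mult_vec_eq_coeff[OF p _ j, symmetric]) (simp add: coeff_V)
      then show "coeff (q * V) (j + r) = 0" using j v(3) by simp
    qed (simp add: coeff_V)
  next
    fix V assume V: "V \<noteq> 0" "\<forall>i\<ge>n. coeff V i = 0" "\<forall>j<n. coeff (q * V) (j + r) = 0"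
    have "Matrix.vec n (coeff V) \<noteq> 0\<^sub>v n"
    proof
      assume "Matrix.vec n (coeff V) = 0\<^sub>v n"
      then have "coeff V i = 0" if "i < n" for i
        using that by (metis index_vec index_zero_vec(1))
      with V(1,2) show False by (metis not_le poly_eq_iff coeff_0)
    qed
    moreover have "toeplitz n p *\<^sub>v Matrix.vec n (coeff V) = 0\<^sub>v n"
    proof (intro eq_vecI)
      fix j assume "j < dim_vec (0\<^sub>v n :: complex Matrix.vec)"
      then show "(toeplitz n p *\<^sub>v Matrix.vec n (coeff V)) $ j = 0\<^sub>v n $ j"
        using toeplitz_mult_vec_eq_coeff[OF p, where V = V] V by auto
    qed (use carrier in auto)
    ultimately show "\<exists>v. v \<in> carrier_vec n \<and> v \<noteq> 0\<^sub>v n \<and> toeplitz n p *\<^sub>v v = 0\<^sub>v n"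
      by (metis vec_carrier)
  qed
  also have "?R \<longleftrightarrow> (\<exists>P Q. (P \<noteq> 0 \<or> Q \<noteq> 0) \<and> (\<forall>i\<ge>r. coeff P i = 0 \<and> coeff Q i = 0) \<and>
      q dvd P + monom 1 (n + r) * Q)"
  proof
    assume ?R
    then obtain V where V: "V \<noteq> 0" "\<forall>i\<ge>n. coeff V i = 0" "\<forall>j<n. coeff (q * V) (j + r) = 0"
      by blast
    define P Q where "P = poly_cutoff r (q * V)" and "Q = poly_shift (n + r) (q * V)"
    have "degree V < n"
      using V(1,2) by (metis leading_coeff_0_iff not_le)
    then have high: "coeff (q * V) i = 0" if "i \<ge> n + 2 * r" for i
      using that degree_mult_le[of q V] q(2) by (intro coeff_eq_0) auto
    have split: "q * V = P + monom 1 (n + r) * Q"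
    proof (rule poly_eqI)
      fix i
      show "coeff (q * V) i = coeff (P + monom 1 (n + r) * Q) i"
        using V(3)[rule_format, of "i - r"]
        by (auto simp: P_def Q_def coeff_poly_cutoff coeff_poly_shift coeff_monom_mult)
    qed
    show "\<exists>P Q. (P \<noteq> 0 \<or> Q \<noteq> 0) \<and> (\<forall>i\<ge>r. coeff P i = 0 \<and> coeff Q i = 0) \<and>
        q dvd P + monom 1 (n + r) * Q"
    proof (rule exI[of _ P], rule exI[of _ Q], intro conjI)
      show "P \<noteq> 0 \<or> Q \<noteq> 0"
        using split V(1) q(1) by auto
      show "\<forall>i\<ge>r. coeff P i = 0 \<and> coeff Q i = 0"
        using high by (auto simp: P_def Q_def coeff_poly_cutoff coeff_poly_shift)
      show "q dvd P + monom 1 (n + r) * Q"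
        by (metis split dvd_triv_left)
    qed
  next
    assume "\<exists>P Q. (P \<noteq> 0 \<or> Q \<noteq> 0) \<and> (\<forall>i\<ge>r. coeff P i = 0 \<and> coeff Q i = 0) \<and>
      q dvd P + monom 1 (n + r) * Q"
    then obtain P Q V
      where PQ: "P \<noteq> 0 \<or> Q \<noteq> 0" "\<forall>i\<ge>r. coeff P i = 0 \<and> coeff Q i = 0"
        and split: "P + monom 1 (n + r) * Q = q * V"
      by (blast elim: dvdE)
    have coeffs: "coeff (q * V) i = 
        (if i < r then coeff P i else if i < n + r then 0 else coeff Q (i - (n + r)))" for i
      unfolding split[symmetric] using PQ(2) by (auto simp: coeff_monom_mult)
    have "q * V \<noteq> 0"
    proof
      assume "q * V = 0"
      then have "coeff P i = 0" "coeff Q i = 0" for i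
        using coeffs[of i] coeffs[of "i + (n + r)"] PQ(2) by (auto split: if_splits)
      with PQ(1) show False by (auto simp: poly_eq_iff)
    qed
    then have "V \<noteq> 0" by auto
    moreover have "degree V < n"
    proof -
      have "coeff (q * V) i = 0" if "i \<ge> n + 2 * r" for i
        using coeffs[of i] PQ(2) that by auto
      with \<open>q * V \<noteq> 0\<close> have "degree (q * V) < n + 2 * r"
        by (metis leading_coeff_0_iff not_le)
      with q \<open>V \<noteq> 0\<close> show ?thesis by (simp add: degree_mult_eq)
    qed
    ultimately show ?R
      using coeffs by (intro exI[of _ V]) (auto intro: coeff_eq_0)
  qed
  finally show ?thesis .
qed

text \<open>The remainder modulo \<open>q\<close> has fewer than \<open>degree q\<close> roots unless it is zero.\<close>

lemma dvd_iff_all_roots: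
  fixes q F :: "'a :: field poly"
  assumes "finite S" "card S = degree q" "q \<noteq> 0" and root: "\<And>t. t \<in> S \<Longrightarrow> poly q t = 0"
  shows "q dvd F \<longleftrightarrow> (\<forall>t\<in>S. poly F t = 0)"
proof
  assume "q dvd F"
  then show "\<forall>t\<in>S. poly F t = 0" by (auto elim!: dvdE simp: root)
next
  assume F: "\<forall>t\<in>S. poly F t = 0"
  have "F mod q = 0"
  proof (rule ccontr)
    assume nz: "F mod q \<noteq> 0"
    have "poly (F mod q) t = 0" if "t \<in> S" for t
      using F root that by (simp add: poly_mod)
    then have "card S \<le> card {t. poly (F mod q) t = 0}"
      using nz by (intro card_mono poly_roots_finite) auto
    also have "\<dots> \<le> degree (F mod q)"
      using nz by (rule card_poly_roots_bound)
    also have "\<dots> < degree q"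
      using nz by (intro degree_mod_less') (use assms in auto)
    finally show False using assms(2) by simp
  qed
  then show "q dvd F" by (simp add: mod_eq_0_iff_dvd)
qed

section \<open>Splitting by parity\<close>

text \<open>The point \<open>exp (\<i>\<theta>)\<close> determines both \<open>cos \<theta>\<close> and \<open>sin \<theta>\<close>; the first singles out \<open>\<theta>\<close> up to
  sign within \<open>\<Theta>\<close>, and the second, being nonzero, then settles the sign.\<close>

lemma card_exp_symmetric:
  fixes \<Theta> :: "complex set"
  assumes "finite \<Theta>" and inj: "inj_on cos \<Theta>" and sin: "\<And>\<theta>. \<theta> \<in> \<Theta> \<Longrightarrow> sin \<theta> \<noteq> 0"
  shows "card ((\<lambda>\<theta>. exp (\<i> * \<theta>)) ` (\<Theta> \<union> uminus ` \<Theta>)) = 2 * card \<Theta>"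
proof -
  have "inj_on (\<lambda>\<theta>. exp (\<i> * \<theta>)) (\<Theta> \<union> uminus ` \<Theta>)"
  proof (rule inj_onI)
    fix x y assume x: "x \<in> \<Theta> \<union> uminus ` \<Theta>" and y: "y \<in> \<Theta> \<union> uminus ` \<Theta>"
      and eq: "exp (\<i> * x) = exp (\<i> * y)"
    have cs: "cos x = cos y" "sin x = sin y"
      using eq by (simp_all add: cos_exp_eq sin_exp_eq exp_minus)
    obtain s t where st: "s \<in> \<Theta>" "t \<in> \<Theta>" "x = s \<or> x = - s" "y = t \<or> y = - t"
      using x y by auto
    with cs(1) have "cos s = cos t" by auto
    with inj st(1,2) have "s = t" by (simp add: inj_on_eq_iff)
    with st cs(2) sin[OF st(1)] show "x = y" by auto
  qed
  moreover have "\<Theta> \<inter> uminus ` \<Theta> = {}"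
  proof (rule ccontr)
    assume "\<Theta> \<inter> uminus ` \<Theta> \<noteq> {}"
    then obtain \<theta> where "- \<theta> \<in> \<Theta>" "\<theta> \<in> \<Theta>" by auto
    then have "- \<theta> = \<theta>" using inj_onD[OF inj, of "- \<theta>" \<theta>] by simp
    with sin[OF \<open>\<theta> \<in> \<Theta>\<close>] show False by simp
  qed
  ultimately show ?thesis
    using assms(1) by (simp add: card_image card_Un_disjoint)
qed

text \<open>Used with \<open>s = cos\<close> and \<open>s = sin\<close>: the homogeneous system that a symmetric, respectively
  antisymmetric, combination of exponentials has to solve. The exponents of \<open>P + t^(n+3) Q\<close> lie
  symmetrically about \<open>(n + 5)/2 = M + 1\<close>, at the distances \<open>M - 1, M, M + 1\<close> on either side.\<close>

definition trig_dependent :: "(complex \<Rightarrow> complex) \<Rightarrow> complex \<Rightarrow> complex set \<Rightarrow> bool" where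
  "trig_dependent s M \<Theta> \<longleftrightarrow> (\<exists>u v w. (u, v, w) \<noteq> (0, 0, 0) \<and>
     (\<forall>\<theta>\<in>\<Theta>. u * s ((M + 1) * \<theta>) + v * s (M * \<theta>) + w * s ((M - 1) * \<theta>) = 0))"

text \<open>Dividing by \<open>t^(M+1)\<close> moves the centre of symmetry of the exponents \<open>0, 1, 2, n + 3, n + 4, n + 5\<close>
  to zero, so that opposite exponents combine to cosines and sines.\<close>

lemma poly_exp_parity:
  fixes \<theta> p\<^sub>0 p\<^sub>1 p\<^sub>2 q\<^sub>0 q\<^sub>1 q\<^sub>2 :: complex and n :: nat
  defines "M \<equiv> (of_nat n + 3) / 2"
  shows "poly ([:p\<^sub>0, p\<^sub>1, p\<^sub>2:] + monom 1 (n + 3) * [:q\<^sub>0, q\<^sub>1, q\<^sub>2:]) (exp (\<i> * \<theta>)) =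
    exp (\<i> * ((M + 1) * \<theta>)) *
      (((p\<^sub>0 + q\<^sub>2) * cos ((M + 1) * \<theta>) + (p\<^sub>1 + q\<^sub>1) * cos (M * \<theta>) + (p\<^sub>2 + q\<^sub>0) * cos ((M - 1) * \<theta>)) +
       \<i> * ((q\<^sub>2 - p\<^sub>0) * sin ((M + 1) * \<theta>) + (q\<^sub>1 - p\<^sub>1) * sin (M * \<theta>) + (q\<^sub>0 - p\<^sub>2) * sin ((M - 1) * \<theta>)))"
proof -
  define X W where "X = exp (\<i> * \<theta>)" and "W = exp (\<i> * (M * \<theta>))"
  have nz: "X \<noteq> 0" "W \<noteq> 0" by (simp_all add: X_def W_def)
  have e: "exp (\<i> * ((M + 1) * \<theta>)) = W * X" "exp (\<i> * ((M - 1) * \<theta>)) = W / X"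
    by (simp_all add: X_def W_def algebra_simps exp_add exp_diff)
  have "X ^ (n + 3) = W * W"
    unfolding X_def W_def M_def exp_of_nat_mult[symmetric] exp_add[symmetric]
    by (rule arg_cong[of _ _ exp]) (simp add: field_simps)
  then have "poly ([:p\<^sub>0, p\<^sub>1, p\<^sub>2:] + monom 1 (n + 3) * [:q\<^sub>0, q\<^sub>1, q\<^sub>2:]) X =
      p\<^sub>0 + p\<^sub>1 * X + p\<^sub>2 * (X * X) + W * W * (q\<^sub>0 + q\<^sub>1 * X + q\<^sub>2 * (X * X))"
    by (simp add: poly_monom algebra_simps)
  also have "\<dots> = W * X *
      (((p\<^sub>0 + q\<^sub>2) * ((W * X + 1 / (W * X)) / 2) + (p\<^sub>1 + q\<^sub>1) * ((W + 1 / W) / 2) +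
         (p\<^sub>2 + q\<^sub>0) * ((W / X + 1 / (W / X)) / 2)) +
       \<i> * ((q\<^sub>2 - p\<^sub>0) * ((W * X - 1 / (W * X)) / (2 * \<i>)) +
         (q\<^sub>1 - p\<^sub>1) * ((W - 1 / W) / (2 * \<i>)) + (q\<^sub>0 - p\<^sub>2) * ((W / X - 1 / (W / X)) / (2 * \<i>))))"
    using nz by (simp add: field_simps)
  finally show ?thesis
    unfolding cos_exp_eq sin_exp_eq exp_minus e inverse_eq_divide
    by (simp add: X_def W_def)
qed

text \<open>Vanishing at both \<open>\<theta>\<close> and \<open>- \<theta>\<close> means that the even and the odd part vanish separately. The
  coefficients of these parts are the sums and the differences of the coefficients of \<open>P\<close> and of
  the reversed \<open>Q\<close>, which can be prescribed independently.\<close>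

lemma ex_dvd_iff_trig_dependent:
  fixes \<Theta> :: "complex set" and n :: nat
  defines "M \<equiv> (of_nat n + 3) / 2"
  assumes \<Theta>: "finite \<Theta>" "inj_on cos \<Theta>" "\<And>\<theta>. \<theta> \<in> \<Theta> \<Longrightarrow> sin \<theta> \<noteq> 0"
    and q: "q \<noteq> 0" "degree q = 2 * card \<Theta>"
    and root: "\<And>\<theta>. \<theta> \<in> \<Theta> \<Longrightarrow> poly q (exp (\<i> * \<theta>)) = 0 \<and> poly q (exp (\<i> * (- \<theta>))) = 0"
  shows "(\<exists>P Q. (P \<noteq> 0 \<or> Q \<noteq> 0) \<and> (\<forall>i\<ge>3. coeff P i = 0 \<and> coeff Q i = 0) \<and>
      q dvd P + monom 1 (n + 3) * Q) \<longleftrightarrow> trig_dependent cos M \<Theta> \<or> trig_dependent sin M \<Theta>"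
proof -
  define Ev where "Ev = (\<lambda>u v w \<theta>. u * cos ((M + 1) * \<theta>) + v * cos (M * \<theta>) + w * cos ((M - 1) * \<theta>))"
  define Od where "Od = (\<lambda>u v w \<theta>. u * sin ((M + 1) * \<theta>) + v * sin (M * \<theta>) + w * sin ((M - 1) * \<theta>))"
  define S where "S = (\<lambda>\<theta>. exp (\<i> * \<theta>)) ` (\<Theta> \<union> uminus ` \<Theta>)"
  have dvd_iff: "q dvd F \<longleftrightarrow> (\<forall>\<theta>\<in>\<Theta>. poly F (exp (\<i> * \<theta>)) = 0 \<and> poly F (exp (\<i> * (- \<theta>))) = 0)" for F
  proof -
    have "q dvd F \<longleftrightarrow> (\<forall>t\<in>S. poly F t = 0)"
      using card_exp_symmetric[OF \<Theta>] q root \<Theta>(1) by (intro dvd_iff_all_roots) (auto simp: S_def)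
    then show ?thesis by (simp add: S_def ball_Un ball_conj_distrib)
  qed
  have parity: "q dvd [:p\<^sub>0, p\<^sub>1, p\<^sub>2:] + monom 1 (n + 3) * [:q\<^sub>0, q\<^sub>1, q\<^sub>2:] \<longleftrightarrow>
      (\<forall>\<theta>\<in>\<Theta>. Ev (p\<^sub>0 + q\<^sub>2) (p\<^sub>1 + q\<^sub>1) (p\<^sub>2 + q\<^sub>0) \<theta> = 0) \<and>
      (\<forall>\<theta>\<in>\<Theta>. Od (q\<^sub>2 - p\<^sub>0) (q\<^sub>1 - p\<^sub>1) (q\<^sub>0 - p\<^sub>2) \<theta> = 0)" for p\<^sub>0 p\<^sub>1 p\<^sub>2 q\<^sub>0 q\<^sub>1 q\<^sub>2
  proof -
    have neg: "Ev u v w (- \<theta>) = Ev u v w \<theta>" "Od u v w (- \<theta>) = - Od u v w \<theta>" for u v w \<theta>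
      by (simp_all add: Ev_def Od_def)
    have poly_eq: "poly ([:p\<^sub>0, p\<^sub>1, p\<^sub>2:] + monom 1 (n + 3) * [:q\<^sub>0, q\<^sub>1, q\<^sub>2:]) (exp (\<i> * \<theta>)) =
        exp (\<i> * ((M + 1) * \<theta>)) *
          (Ev (p\<^sub>0 + q\<^sub>2) (p\<^sub>1 + q\<^sub>1) (p\<^sub>2 + q\<^sub>0) \<theta> + \<i> * Od (q\<^sub>2 - p\<^sub>0) (q\<^sub>1 - p\<^sub>1) (q\<^sub>0 - p\<^sub>2) \<theta>)" for \<theta>
      by (simp only: poly_exp_parity M_def Ev_def Od_def)
    have "x + \<i> * y = 0 \<and> x + \<i> * (- y) = 0 \<longleftrightarrow> x = 0 \<and> y = 0" for x y :: complex
      by (auto simp: add_eq_0_iff)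
    then have "q dvd [:p\<^sub>0, p\<^sub>1, p\<^sub>2:] + monom 1 (n + 3) * [:q\<^sub>0, q\<^sub>1, q\<^sub>2:] \<longleftrightarrow>
      (\<forall>\<theta>\<in>\<Theta>. Ev (p\<^sub>0 + q\<^sub>2) (p\<^sub>1 + q\<^sub>1) (p\<^sub>2 + q\<^sub>0) \<theta> = 0 \<and> Od (q\<^sub>2 - p\<^sub>0) (q\<^sub>1 - p\<^sub>1) (q\<^sub>0 - p\<^sub>2) \<theta> = 0)"
      unfolding dvd_iff poly_eq neg
      by (simp only: mult_eq_0_iff exp_not_eq_zero simp_thms)
    then show ?thesis by blast
  qed
  have small: "P = [:coeff P 0, coeff P 1, coeff P 2:]" if "\<forall>i\<ge>3. coeff P i = 0" for P :: "complex poly"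
    using that by (intro poly_eqI) (auto simp: coeff_pCons numeral_eq_Suc split: nat.splits)
  have small': "\<forall>i\<ge>3. coeff [:x, y, z:] i = 0" for x y z :: complex
    by (auto simp: coeff_pCons split: nat.splits)
  show ?thesis
  proof
    assume "\<exists>P Q. (P \<noteq> 0 \<or> Q \<noteq> 0) \<and> (\<forall>i\<ge>3. coeff P i = 0 \<and> coeff Q i = 0) \<and>
      q dvd P + monom 1 (n + 3) * Q"
    then obtain P Q where PQ: "P \<noteq> 0 \<or> Q \<noteq> 0" "\<forall>i\<ge>3. coeff P i = 0" "\<forall>i\<ge>3. coeff Q i = 0"
      "q dvd P + monom 1 (n + 3) * Q" by blast
    obtain p\<^sub>0 p\<^sub>1 p\<^sub>2 q\<^sub>0 q\<^sub>1 q\<^sub>2 where P: "P = [:p\<^sub>0, p\<^sub>1, p\<^sub>2:]" and Q: "Q = [:q\<^sub>0, q\<^sub>1, q\<^sub>2:]"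
      using small PQ(2,3) by blast
    have "(p\<^sub>0 + q\<^sub>2, p\<^sub>1 + q\<^sub>1, p\<^sub>2 + q\<^sub>0) \<noteq> (0, 0, 0) \<or> (q\<^sub>2 - p\<^sub>0, q\<^sub>1 - p\<^sub>1, q\<^sub>0 - p\<^sub>2) \<noteq> (0, 0, 0)"
      using PQ(1) by (auto simp: P Q)
    then show "trig_dependent cos M \<Theta> \<or> trig_dependent sin M \<Theta>"
      using PQ(4) unfolding P Q parity trig_dependent_def Ev_def Od_def by blast
  next
    assume "trig_dependent cos M \<Theta> \<or> trig_dependent sin M \<Theta>"
    then have *: "(\<exists>u v w. (u, v, w) \<noteq> (0, 0, 0) \<and> (\<forall>\<theta>\<in>\<Theta>. Ev u v w \<theta> = 0)) \<or>
        (\<exists>u v w. (u, v, w) \<noteq> (0, 0, 0) \<and> (\<forall>\<theta>\<in>\<Theta>. Od u v w \<theta> = 0))"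
      unfolding trig_dependent_def Ev_def Od_def .
    have double: "Ev (u + u) (v + v) (w + w) \<theta> = 2 * Ev u v w \<theta>"
        "Od (u - - u) (v - - v) (w - - w) \<theta> = 2 * Od u v w \<theta>"
      and zero: "Ev 0 0 0 \<theta> = 0" "Od 0 0 0 \<theta> = 0" for u v w \<theta>
      by (simp_all add: Ev_def Od_def algebra_simps)
    from * show "\<exists>P Q. (P \<noteq> 0 \<or> Q \<noteq> 0) \<and> (\<forall>i\<ge>3. coeff P i = 0 \<and> coeff Q i = 0) \<and>
      q dvd P + monom 1 (n + 3) * Q"
    proof (elim disjE exE conjE)
      fix u v w assume 1: "(u, v, w) \<noteq> (0, 0, 0)" "\<forall>\<theta>\<in>\<Theta>. Ev u v w \<theta> = 0"
      \<comment> \<open>A palindromic combination has no odd part.\<close>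
      have "q dvd [:u, v, w:] + monom 1 (n + 3) * [:w, v, u:]"
        unfolding parity double using 1(2) by (simp add: zero)
      moreover have "[:u, v, w:] \<noteq> 0 \<or> [:w, v, u:] \<noteq> 0"
        using 1(1) by auto
      ultimately show ?thesis using small' by blast
    next
      fix u v w assume 2: "(u, v, w) \<noteq> (0, 0, 0)" "\<forall>\<theta>\<in>\<Theta>. Od u v w \<theta> = 0"
      \<comment> \<open>An antipalindromic combination has no even part.\<close>
      have "q dvd [:- u, - v, - w:] + monom 1 (n + 3) * [:w, v, u:]"
        unfolding parity double using 2(2) by (simp add: zero)
      moreover have "[:- u, - v, - w:] \<noteq> 0 \<or> [:w, v, u:] \<noteq> 0"
        using 2(1) by auto
      ultimately show ?thesis using small' by blast
    qed
  qed
qed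

section \<open>The three by three systems\<close>

lemma homogeneous_3x3_solvable_iff:
  fixes a b c :: "3 \<Rightarrow> 'a :: field"
  shows "(\<exists>u v w. (u, v, w) \<noteq> (0, 0, 0) \<and> (\<forall>k. u * a k + v * b k + w * c k = 0)) \<longleftrightarrow>
    a 1 * (b 2 * c 3 - b 3 * c 2) + a 2 * (b 3 * c 1 - b 1 * c 3) + a 3 * (b 1 * c 2 - b 2 * c 1) = 0"
proof -
  define A :: "'a ^ 3 ^ 3" where "A = (\<chi> k. vector [a k, b k, c k])"
  have mult: "(A *v x) $ k = x $ 1 * a k + x $ 2 * b k + x $ 3 * c k" for x k
    by (simp add: A_def matrix_vector_mult_def sum_3 vector_3 mult.commute)
  have "(\<exists>u v w. (u, v, w) \<noteq> (0, 0, 0) \<and> (\<forall>k. u * a k + v * b k + w * c k = 0)) \<longleftrightarrow>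
      (\<exists>x. x \<noteq> 0 \<and> A *v x = 0)"
  proof
    assume "\<exists>u v w. (u, v, w) \<noteq> (0, 0, 0) \<and> (\<forall>k. u * a k + v * b k + w * c k = 0)"
    then obtain u v w where uvw: "(u, v, w) \<noteq> (0, 0, 0)" "\<forall>k. u * a k + v * b k + w * c k = 0"
      by blast
    define x :: "'a ^ 3" where "x = vector [u, v, w]"
    have x: "x $ 1 = u" "x $ 2 = v" "x $ 3 = w"
      by (simp_all add: x_def vector_3)
    with uvw(1) have "x \<noteq> 0" by auto
    moreover have "A *v x = 0"
      unfolding Finite_Cartesian_Product.vec_eq_iff mult x using uvw(2) by simp
    ultimately show "\<exists>x. x \<noteq> 0 \<and> A *v x = 0" by blast
  next
    assume "\<exists>x. x \<noteq> 0 \<and> A *v x = 0"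
    then obtain x where x: "x \<noteq> 0" "A *v x = 0" by blast
    from x(1) have "(x $ 1, x $ 2, x $ 3) \<noteq> (0, 0, 0)"
      by (auto simp: Finite_Cartesian_Product.vec_eq_iff forall_3)
    moreover have "\<forall>k. x $ 1 * a k + x $ 2 * b k + x $ 3 * c k = 0"
      unfolding mult[symmetric] x(2) by simp
    ultimately show "\<exists>u v w. (u, v, w) \<noteq> (0, 0, 0) \<and> (\<forall>k. u * a k + v * b k + w * c k = 0)"
      by blast
  qed
  also have "\<dots> \<longleftrightarrow> Determinants.det A = 0"
    using invertible_det_nz[of A] matrix_left_invertible_ker[of A] invertible_left_inverse[of A] by blast
  also have "Determinants.det A =
      a 1 * (b 2 * c 3 - b 3 * c 2) + a 2 * (b 3 * c 1 - b 1 * c 3) + a 3 * (b 1 * c 2 - b 2 * c 1)"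
    by (simp add: A_def det_3 vector_3 algebra_simps)
  finally show ?thesis .
qed

text \<open>The addition theorems turn the functions at \<open>M + 1\<close> and \<open>M - 1\<close> into \<open>z C - S\<close> and \<open>z C + S\<close>, where
  \<open>C\<close> is the value at \<open>M\<close> and \<open>z = cos \<theta>\<close>; column operations reduce the determinant to that of
  the columns \<open>z C\<close>, \<open>C\<close>, \<open>S\<close>, here expanded along \<open>S\<close>. One computation thus serves the
  cosine and the sine system.\<close>

lemma prosthaphaeresis_solvable_iff:
  fixes z C S :: "3 \<Rightarrow> complex"
  shows "(\<exists>u v w. (u, v, w) \<noteq> (0, 0, 0) \<and>
      (\<forall>k. u * (z k * C k - S k) + v * C k + w * (z k * C k + S k) = 0)) \<longleftrightarrow>
    S 1 * C 2 * C 3 * (z 2 - z 3) + S 2 * C 3 * C 1 * (z 3 - z 1) + S 3 * C 1 * C 2 * (z 1 - z 2) = 0"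
proof -
  let ?a = "\<lambda>k. z k * C k - S k" and ?c = "\<lambda>k. z k * C k + S k"
  have "?a 1 * (C 2 * ?c 3 - C 3 * ?c 2) + ?a 2 * (C 3 * ?c 1 - C 1 * ?c 3) + ?a 3 * (C 1 * ?c 2 - C 2 * ?c 1)
    = 2 * (S 1 * C 2 * C 3 * (z 2 - z 3) + S 2 * C 3 * C 1 * (z 3 - z 1) + S 3 * C 1 * C 2 * (z 1 - z 2))"
    by (simp add: algebra_simps)
  then show ?thesis
    unfolding homogeneous_3x3_solvable_iff
    by (simp only: mult_eq_0_iff numeral_neq_zero zero_neq_numeral simp_thms)
qed

lemma trig_dependent_cos_iff:
  fixes \<theta> :: "3 \<Rightarrow> complex"
  shows "trig_dependent cos M (range \<theta>) \<longleftrightarrow>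
    (let C = \<lambda>k. cos (M * \<theta> k); S = \<lambda>k. sin (\<theta> k) * sin (M * \<theta> k); z = \<lambda>k. cos (\<theta> k) in
      S 1 * C 2 * C 3 * (z 2 - z 3) + S 2 * C 3 * C 1 * (z 3 - z 1) + S 3 * C 1 * C 2 * (z 1 - z 2) = 0)"
proof -
  have "cos ((M + 1) * t) = cos t * cos (M * t) - sin t * sin (M * t)"
    "cos ((M - 1) * t) = cos t * cos (M * t) + sin t * sin (M * t)" for t
    by (simp_all add: distrib_right left_diff_distrib cos_add cos_diff)
  then show ?thesis
    unfolding Let_def prosthaphaeresis_solvable_iff[symmetric] trig_dependent_def by simp
qed

lemma trig_dependent_sin_iff:
  fixes \<theta> :: "3 \<Rightarrow> complex"
  shows "trig_dependent sin M (range \<theta>) \<longleftrightarrow>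
    (let C = \<lambda>k. sin (M * \<theta> k); S = \<lambda>k. - (sin (\<theta> k) * cos (M * \<theta> k)); z = \<lambda>k. cos (\<theta> k) in
      S 1 * C 2 * C 3 * (z 2 - z 3) + S 2 * C 3 * C 1 * (z 3 - z 1) + S 3 * C 1 * C 2 * (z 1 - z 2) = 0)"
proof -
  have "sin ((M + 1) * t) = cos t * sin (M * t) - - (sin t * cos (M * t))"
    "sin ((M - 1) * t) = cos t * sin (M * t) + - (sin t * cos (M * t))" for t
    by (simp_all add: distrib_right left_diff_distrib sin_add sin_diff)
  then show ?thesis
    unfolding Let_def prosthaphaeresis_solvable_iff[symmetric] trig_dependent_def by simp
qed

text \<open>The three numbers \<open>1 - d\<close>, \<open>1 - d\<omega>\<close>, \<open>1 - d\<omega>\<^sup>2\<close> are the cosines of the three angles. Their cyclic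
  differences form a geometric progression with ratio \<open>\<omega>\<close>, whose first term is a common
  factor.\<close>

lemma cube_root_of_unity_differences:
  fixes \<omega> d :: complex
  assumes "\<omega> ^ 3 = 1" "\<omega> \<noteq> 1" "d \<noteq> 0"
  shows "x * ((1 - d * \<omega>) - (1 - d * \<omega>\<^sup>2)) + y * ((1 - d * \<omega>\<^sup>2) - (1 - d)) + z * ((1 - d) - (1 - d * \<omega>)) = 0
    \<longleftrightarrow> x + \<omega> * y + \<omega>\<^sup>2 * z = 0"
proof -
  have "x * ((1 - d * \<omega>) - (1 - d * \<omega>\<^sup>2)) + y * ((1 - d * \<omega>\<^sup>2) - (1 - d)) + z * ((1 - d) - (1 - d * \<omega>))
    = d * (\<omega>\<^sup>2 - \<omega>) * (x + \<omega> * y + \<omega>\<^sup>2 * z)"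
  proof -
    have "(\<omega>\<^sup>2 - \<omega>) * \<omega> = \<omega> ^ 3 - \<omega>\<^sup>2" "(\<omega>\<^sup>2 - \<omega>) * \<omega>\<^sup>2 = \<omega> ^ 3 * \<omega> - \<omega> ^ 3"
      by (simp_all add: power2_eq_square power3_eq_cube left_diff_distrib)
    then have "(\<omega>\<^sup>2 - \<omega>) * \<omega> = 1 - \<omega>\<^sup>2" "(\<omega>\<^sup>2 - \<omega>) * \<omega>\<^sup>2 = \<omega> - 1"
      unfolding assms(1) by simp_all
    then have "d * (\<omega>\<^sup>2 - \<omega>) * (x + \<omega> * y + \<omega>\<^sup>2 * z) =
        d * ((\<omega>\<^sup>2 - \<omega>) * x + (1 - \<omega>\<^sup>2) * y + (\<omega> - 1) * z)"
      by (simp only: distrib_left mult.assoc[symmetric]) (simp only: mult.assoc)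
    then show ?thesis by (simp add: algebra_simps)
  qed
  moreover have "\<omega>\<^sup>2 - \<omega> \<noteq> 0"
    using assms(1,2) by (auto simp: power2_eq_square power3_eq_cube)
  ultimately show ?thesis using assms(3) by simp
qed

text \<open>The second and the third term are complex conjugates, so the equation is real.\<close>

lemma conjugate_pair_sum_eq_0_iff:
  fixes \<omega> s c :: complex and s\<^sub>1 c\<^sub>1 :: real
  assumes "cnj \<omega> = \<omega>\<^sup>2"
  shows "of_real s\<^sub>1 * c * cnj c + \<omega> * (s * cnj c * of_real c\<^sub>1) + \<omega>\<^sup>2 * (cnj s * of_real c\<^sub>1 * c) = 0 \<longleftrightarrow>
    s\<^sub>1 * (cmod c)\<^sup>2 + 2 * c\<^sub>1 * Re (\<omega> * s * cnj c) = 0"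
proof -
  have "of_real s\<^sub>1 * c * cnj c + \<omega> * (s * cnj c * of_real c\<^sub>1) + \<omega>\<^sup>2 * (cnj s * of_real c\<^sub>1 * c) =
      of_real s\<^sub>1 * (c * cnj c) + of_real c\<^sub>1 * (\<omega> * s * cnj c + cnj (\<omega> * s * cnj c))"
    by (simp add: assms algebra_simps)
  also have "\<dots> = of_real (s\<^sub>1 * (cmod c)\<^sup>2 + 2 * c\<^sub>1 * Re (\<omega> * s * cnj c))"
    unfolding complex_add_cnj complex_norm_square[symmetric]
    by (simp only: of_real_add of_real_mult mult_ac)
  finally show ?thesis by (simp only: of_real_eq_0_iff)
qed

section \<open>Real and imaginary parts\<close>

lemma sin_mult_cnj_cos:
  "sin z * cnj (cos z) = Complex (sin (2 * Re z) / 2) (sinh (2 * Im z) / 2)"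
proof -
  have "sin z * cnj (cos z) = (sin (z + cnj z) + sin (z - cnj z)) / 2"
    unfolding cnj_cos sin_times_cos ..
  also have "\<dots> = (sin (of_real (2 * Re z)) + sin (of_real (2 * Im z) * \<i>)) / 2"
    by (simp add: complex_add_cnj complex_diff_cnj)
  also have "\<dots> = Complex (sin (2 * Re z) / 2) (sinh (2 * Im z) / 2)"
    by (simp add: complex_eq_iff Re_sin Im_sin sinh_field_def)
  finally show ?thesis .
qed

lemma cmod_cos_squared: "(cmod (cos z))\<^sup>2 = (cos (2 * Re z) + cosh (2 * Im z)) / 2"
proof -
  have "complex_of_real ((cmod (cos z))\<^sup>2) = (cos (z - cnj z) + cos (z + cnj z)) / 2"
    unfolding complex_norm_square cnj_cos cos_times_cos by simp
  also have "\<dots> = (cos (of_real (2 * Im z) * \<i>) + cos (of_real (2 * Re z))) / 2"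
    by (simp add: complex_add_cnj complex_diff_cnj)
  finally show ?thesis
    by (simp add: complex_eq_iff Re_cos cosh_field_def add.commute)
qed

lemma cmod_sin_squared: "(cmod (sin z))\<^sup>2 = (cosh (2 * Im z) - cos (2 * Re z)) / 2"
proof -
  have "complex_of_real ((cmod (sin z))\<^sup>2) = (cos (z - cnj z) - cos (z + cnj z)) / 2"
    unfolding complex_norm_square cnj_sin sin_times_sin by simp
  also have "\<dots> = (cos (of_real (2 * Im z) * \<i>) - cos (of_real (2 * Re z))) / 2"
    by (simp add: complex_add_cnj complex_diff_cnj)
  finally show ?thesis
    by (simp add: complex_eq_iff Re_cos cosh_field_def)
qed

text \<open>Cleared of denominators, the equation for the tangent has no solution at the poles, where
  its left-hand side is nonzero and its right-hand side zero. So it captures the finite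
  equation, poles excluded.\<close>

lemma tan_eq_iff_mult:
  assumes "s > 0" "D > 0"
  shows "tan_eq x (2 * (N / (s * D))) \<longleftrightarrow> s * sin x * D = 2 * cos x * N"
proof (cases "cos x = 0")
  case True
  then have "sin x \<noteq> 0" using sin_cos_squared_add[of x] by auto
  with True assms show ?thesis by (simp add: tan_eq_def)
next
  case False
  with assms show ?thesis by (auto simp: tan_eq_def tan_def field_simps)
qed

lemma tan_eq_recip_iff_mult:
  assumes "s > 0" "D > 0"
  shows "tan_eq_recip x (2 * (N / (s * D))) \<longleftrightarrow> s * cos x * D = 2 * sin x * N"
  using assms by (auto simp: tan_eq_recip_def field_simps)

section \<open>The eigenvalue equation\<close>

text \<open>At \<open>t = exp (\<i>\<theta>)\<close> one has \<open>(t - 1)\<^sup>2 = (2 cos \<theta> - 2) t\<close>, so the hypothesis on \<open>\<mu>\<close> says that the points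
  \<open>exp (\<plusminus>\<i>\<theta>)\<close> are roots of \<open>(t - 1)\<^sup>6 - \<mu>t\<^sup>3\<close>. There are six of them, hence they are all the roots and
  simple.\<close>

lemma det_toeplitz_a_symbol_eq_0_iff:
  fixes \<Theta> :: "complex set"
  assumes \<Theta>: "card \<Theta> = 3" "inj_on cos \<Theta>" "\<And>\<theta>. \<theta> \<in> \<Theta> \<Longrightarrow> sin \<theta> \<noteq> 0"
    and \<mu>: "\<And>\<theta>. \<theta> \<in> \<Theta> \<Longrightarrow> (2 * cos \<theta> - 2) ^ 3 = \<mu>"
  shows "Determinant.det (toeplitz n (\<lambda>t. a_symbol t - \<mu>)) = 0 \<longleftrightarrow>
    trig_dependent cos ((of_nat n + 3) / 2) \<Theta> \<or> trig_dependent sin ((of_nat n + 3) / 2) \<Theta>"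
proof -
  define q where "q = [:-1, 1:] ^ 6 - monom \<mu> 3"
  have poly_q: "poly q t = (t - 1) ^ 6 - \<mu> * t ^ 3" for t
    by (simp add: q_def poly_monom)
  have "degree ([:-1, 1 :: complex:] ^ 6 + monom (- \<mu>) 3) = degree ([:-1, 1 :: complex:] ^ 6)"
    using degree_monom_le[of "- \<mu>" 3] by (intro degree_add_eq_left) (simp add: degree_linear_power)
  then have deg: "degree q = 6"
    by (simp add: q_def degree_linear_power flip: minus_monom)
  then have "q \<noteq> 0" and deg': "degree q = 2 * 3" by auto
  have symbol: "(a_symbol (cis \<theta>) - \<mu>) * cis \<theta> ^ 3 = poly q (cis \<theta>)" for \<theta>
  proof -
    have "(cis \<theta> - 2 + 1 / cis \<theta>) * cis \<theta> = (cis \<theta> - 1)\<^sup>2"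
      by (simp add: field_simps power2_eq_square)
    then have "((cis \<theta> - 2 + 1 / cis \<theta>) * cis \<theta>) ^ 3 = (cis \<theta> - 1) ^ 6"
      by simp
    then show ?thesis
      by (simp add: poly_q a_symbol_def power_mult_distrib left_diff_distrib)
  qed
  have root: "poly q (exp (\<i> * \<theta>)) = 0" if "(2 * cos \<theta> - 2) ^ 3 = \<mu>" for \<theta>
  proof -
    have "(exp (\<i> * \<theta>) - 1)\<^sup>2 = (2 * cos \<theta> - 2) * exp (\<i> * \<theta>)"
      by (simp add: cos_exp_eq exp_minus field_simps power2_eq_square)
    then have "((exp (\<i> * \<theta>) - 1)\<^sup>2) ^ 3 = \<mu> * exp (\<i> * \<theta>) ^ 3"
      by (simp only: power_mult_distrib that)
    then show ?thesis by (simp add: poly_q)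
  qed
  have "finite \<Theta>" using \<Theta>(1) by (intro card_ge_0_finite) simp
  show ?thesis
    unfolding det_toeplitz_eq_0_iff_dvd[OF symbol \<open>q \<noteq> 0\<close> deg']
  proof (rule ex_dvd_iff_trig_dependent[OF \<open>finite \<Theta>\<close> \<Theta>(2,3) \<open>q \<noteq> 0\<close>])
    fix \<theta> assume "\<theta> \<in> \<Theta>"
    then show "poly q (exp (\<i> * \<theta>)) = 0 \<and> poly q (exp (\<i> * - \<theta>)) = 0"
      using root[of \<theta>] root[of "- \<theta>"] \<mu> by simp
  qed (simp_all add: deg \<Theta>(1))
qed

theorem theorem2p1:
  fixes n :: nat and \<phi> :: real and \<beta> :: "real \<Rightarrow> complex"
  assumes "n \<ge> 1"
    and "is_beta_branch \<beta>"
    and "\<phi> \<in> {0<..<pi}"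
  shows "Determinant.det (toeplitz n (\<lambda>t. a_symbol t - g \<phi>)) = 0 \<longleftrightarrow>
    tan_eq ((real n + 3) / 2 * \<phi>) (f_fun \<beta> n \<phi>) \<or>
    tan_eq_recip ((real n + 3) / 2 * \<phi>) (h_fun \<beta> n \<phi>)"
proof -
  define M where "M = (real n + 3) / 2"
  define b where "b = \<beta> \<phi>"
  define \<omega> where "\<omega> = exp (2 * of_real pi * \<i> / 3)"
  define d where "d = 1 - cos \<phi>"
  define \<theta> :: "3 \<Rightarrow> complex" where "\<theta> = ($) (vector [of_real \<phi>, b, cnj b])"
  have \<theta>: "\<theta> 1 = of_real \<phi>" "\<theta> 2 = b" "\<theta> 3 = cnj b"
    by (simp_all add: \<theta>_def vector_3)
  have \<phi>: "0 < \<phi>" "\<phi> < pi" using assms(3) by auto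
  have sin_pos: "sin \<phi> > 0" using \<phi> by (rule sin_gt_zero)
  have "d > 0" using cos_monotone_0_pi[of 0 \<phi>] \<phi> by (simp add: d_def)

  have \<omega>_cis: "\<omega> = cis (2 * pi / 3)"
    by (simp add: \<omega>_def cis_conv_exp mult_ac)
  have \<omega>_parts: "Re \<omega> = - 1 / 2" "Im \<omega> = sqrt 3 / 2"
    using cos_120 sin_120 by (simp_all add: \<omega>_cis mult.commute)
  have cnj_\<omega>: "cnj \<omega> = \<omega>\<^sup>2"
    by (simp add: complex_eq_iff Re_power2 Im_power2 \<omega>_parts power_divide)
  have "\<omega> ^ 3 = 1"
    by (simp add: \<omega>_cis Complex.DeMoivre)
  have "\<omega> \<noteq> 1" "\<omega>\<^sup>2 \<noteq> 1" "\<omega> \<noteq> \<omega>\<^sup>2"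
    unfolding cnj_\<omega>[symmetric] by (simp_all add: complex_eq_iff \<omega>_parts)

  have cos_b: "cos b = 1 - of_real d * \<omega>"
    using assms(2) \<phi> unfolding is_beta_branch_def b_def d_def \<omega>_def by simp
  then have cos_cnj_b: "cos (cnj b) = 1 - of_real d * \<omega>\<^sup>2"
    by (simp add: cnj_\<omega> flip: cnj_cos)
  have cos_\<phi>: "cos (of_real \<phi>) = 1 - complex_of_real d"
    by (simp add: d_def cos_of_real)
  have "sin b \<noteq> 0"
    using assms(2,3) unfolding is_beta_branch_def b_def by fastforce
  have "Im (cos b) \<noteq> 0"
    using \<open>d > 0\<close> by (simp add: cos_b \<omega>_parts)
  then have "Im b \<noteq> 0" by (auto simp: Im_cos)

  have cos_neq: "cos (of_real \<phi>) \<noteq> cos b" "cos (of_real \<phi>) \<noteq> cos (cnj b)" "cos b \<noteq> cos (cnj b)"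
    using \<open>d > 0\<close> \<open>\<omega> \<noteq> 1\<close> \<open>\<omega>\<^sup>2 \<noteq> 1\<close> \<open>\<omega> \<noteq> \<omega>\<^sup>2\<close> by (auto simp: cos_b cos_cnj_b cos_\<phi>)
  have range: "range \<theta> = {of_real \<phi>, b, cnj b}"
    by (simp add: UNIV_3 \<theta>)
  have args: "c_fun \<beta> \<phi> = Re b" "b_fun \<beta> \<phi> = Im b" "2 * (M * x) = (real n + 3) * x" for x
    by (simp_all add: b_def c_fun_def b_fun_def M_def)
  \<comment> \<open>The constants \<open>B\<close> and \<open>C\<close> are taken with the factor \<open>exp (-\<pi>\<i>/3) = - \<omega>\<close>, which is where the
    weight \<open>\<omega>\<close> of the angle \<open>\<beta>(\<phi>)\<close> enters.\<close>
  have \<omega>_sin_b: "\<omega> * sin b = - Complex (B_fun \<beta> \<phi>) (- C_fun \<beta> \<phi>)"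
  proof -
    have "\<omega> = - exp (- (of_real pi * \<i> / 3))"
    proof -
      have "\<omega> = exp (of_real pi * \<i> + - (of_real pi * \<i> / 3))"
        unfolding \<omega>_def by (rule arg_cong[of _ _ exp]) (simp add: field_simps)
      then show ?thesis by (simp only: exp_add exp_pi_i) simp
    qed
    then have "\<omega> * sin b = - (sin b * exp (- (of_real pi * \<i> / 3)))"
      by simp
    then show ?thesis
      by (simp only: B_fun_def C_fun_def b_def minus_minus complex_surj)
  qed
  \<comment> \<open>As \<open>\<beta>(\<phi>)\<close> is not real, the denominators of \<open>f\<close> and \<open>h\<close> are positive.\<close>
  have cosh_gt: "cosh ((real n + 3) * b_fun \<beta> \<phi>) > 1"
  proof -
    have "(real n + 3) * b_fun \<beta> \<phi> \<noteq> 0"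
      using \<open>Im b \<noteq> 0\<close> by (simp add: b_fun_def b_def)
    then have "\<bar>(real n + 3) * b_fun \<beta> \<phi>\<bar> > 0" by simp
    from cosh_real_strict_mono[OF order_refl this] show ?thesis by simp
  qed
  have "complex_of_real d \<noteq> 0" using \<open>d > 0\<close> by simp
  note differences = cube_root_of_unity_differences[OF \<open>\<omega> ^ 3 = 1\<close> \<open>\<omega> \<noteq> 1\<close> this]
  have "Determinant.det (toeplitz n (\<lambda>t. a_symbol t - g \<phi>)) = 0 \<longleftrightarrow>
    trig_dependent cos (of_real M) (range \<theta>) \<or> trig_dependent sin (of_real M) (range \<theta>)"
  proof -
    have M: "of_real M = (of_nat n + 3) / (2 :: complex)" by (simp add: M_def)
    moreover have "card (range \<theta>) = 3"
      using cos_neq by (auto simp: range card_insert_if)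
    moreover have "inj_on cos (range \<theta>)"
      using cos_neq by (auto simp: range)
    moreover have "sin t \<noteq> 0" if "t \<in> range \<theta>" for t
      using that sin_pos \<open>sin b \<noteq> 0\<close> by (auto simp: range sin_of_real simp flip: cnj_sin)
    moreover have "(2 * cos t - 2) ^ 3 = g \<phi>" if "t \<in> range \<theta>" for t
    proof -
      have "2 * cos t - 2 = - 2 * of_real d \<or> 2 * cos t - 2 = - 2 * of_real d * \<omega> \<or>
          2 * cos t - 2 = - 2 * of_real d * \<omega>\<^sup>2"
        using that by (auto simp: range cos_b cos_cnj_b cos_\<phi>)
      moreover have "(\<omega>\<^sup>2) ^ 3 = 1"
        using \<open>\<omega> ^ 3 = 1\<close> by (metis power_mult mult.commute power_one)
      ultimately have "(2 * cos t - 2) ^ 3 = (- 2 * of_real d) ^ 3"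
        using \<open>\<omega> ^ 3 = 1\<close> by (elim disjE) (simp_all only: power_mult_distrib mult_1_right)
      also have "- 2 * of_real d = cis \<phi> - 2 + 1 / cis \<phi>"
        by (subst divide_inverse, subst cis_inverse) (simp add: complex_eq_iff d_def)
      finally show ?thesis by (simp add: g_def a_symbol_def)
    qed
    ultimately show ?thesis
      using det_toeplitz_a_symbol_eq_0_iff[of "range \<theta>" "g \<phi>" n] unfolding M by simp
  qed
  also have trig_cos: "trig_dependent cos (of_real M) (range \<theta>) \<longleftrightarrow> tan_eq (M * \<phi>) (f_fun \<beta> n \<phi>)"
  proof -
    define D where "D = cos ((real n + 3) * c_fun \<beta> \<phi>) + cosh ((real n + 3) * b_fun \<beta> \<phi>)"
    define N where "N = B_fun \<beta> \<phi> * sin ((real n + 3) * c_fun \<beta> \<phi>)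
      + C_fun \<beta> \<phi> * sinh ((real n + 3) * b_fun \<beta> \<phi>)"
    have "D > 0"
      using cosh_gt cos_ge_minus_one[of "(real n + 3) * c_fun \<beta> \<phi>"] unfolding D_def by linarith
    have "trig_dependent cos (of_real M) (range \<theta>) \<longleftrightarrow>
        sin \<phi> * sin (M * \<phi>) * (cmod (cos (of_real M * b)))\<^sup>2 +
        2 * cos (M * \<phi>) * Re (\<omega> * (sin b * sin (of_real M * b)) * cnj (cos (of_real M * b))) = 0"
      unfolding trig_dependent_cos_iff Let_def \<theta> cos_b cos_cnj_b cos_\<phi> differences
        conjugate_pair_sum_eq_0_iff[OF cnj_\<omega>, symmetric]
      by (simp add: sin_of_real cos_of_real cnj_sin cnj_cos flip: of_real_mult)
    also have "(cmod (cos (of_real M * b)))\<^sup>2 = D / 2"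
      by (simp add: cmod_cos_squared D_def args)
    also have "Re (\<omega> * (sin b * sin (of_real M * b)) * cnj (cos (of_real M * b))) = - (N / 2)"
    proof -
      have "\<omega> * (sin b * sin (of_real M * b)) * cnj (cos (of_real M * b)) =
          (\<omega> * sin b) * (sin (of_real M * b) * cnj (cos (of_real M * b)))"
        by (simp only: mult.assoc)
      then show ?thesis
        unfolding \<omega>_sin_b sin_mult_cnj_cos by (simp add: args N_def add_divide_distrib)
    qed
    also have "(sin \<phi> * sin (M * \<phi>) * (D / 2) + 2 * cos (M * \<phi>) * - (N / 2) = 0) \<longleftrightarrow>
        tan_eq (M * \<phi>) (f_fun \<beta> n \<phi>)"
      unfolding f_fun_def D_def[symmetric] N_def[symmetric] tan_eq_iff_mult[OF sin_pos \<open>D > 0\<close>]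
      by (auto simp: field_simps)
    finally show ?thesis .
  qed
  also have "trig_dependent sin (of_real M) (range \<theta>) \<longleftrightarrow> tan_eq_recip (M * \<phi>) (h_fun \<beta> n \<phi>)"
  proof -
    define D where "D = - cos ((real n + 3) * c_fun \<beta> \<phi>) + cosh ((real n + 3) * b_fun \<beta> \<phi>)"
    define N where "N = B_fun \<beta> \<phi> * sin ((real n + 3) * c_fun \<beta> \<phi>)
      - C_fun \<beta> \<phi> * sinh ((real n + 3) * b_fun \<beta> \<phi>)"
    have "D > 0"
      using cosh_gt cos_le_one[of "(real n + 3) * c_fun \<beta> \<phi>"] unfolding D_def by linarith
    have "trig_dependent sin (of_real M) (range \<theta>) \<longleftrightarrow>
        - (sin \<phi> * cos (M * \<phi>)) * (cmod (sin (of_real M * b)))\<^sup>2 +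
        2 * sin (M * \<phi>) * Re (\<omega> * - (sin b * cos (of_real M * b)) * cnj (sin (of_real M * b))) = 0"
      unfolding trig_dependent_sin_iff Let_def \<theta> cos_b cos_cnj_b cos_\<phi> differences
        conjugate_pair_sum_eq_0_iff[OF cnj_\<omega>, symmetric]
      by (simp add: sin_of_real cos_of_real cnj_sin cnj_cos flip: of_real_mult)
    also have "(cmod (sin (of_real M * b)))\<^sup>2 = D / 2"
      by (simp add: cmod_sin_squared D_def args)
    also have "Re (\<omega> * - (sin b * cos (of_real M * b)) * cnj (sin (of_real M * b))) = N / 2"
    proof -
      have "\<omega> * - (sin b * cos (of_real M * b)) * cnj (sin (of_real M * b)) =
          - (\<omega> * sin b) * cnj (sin (of_real M * b) * cnj (cos (of_real M * b)))"
        by (simp only: complex_cnj_mult complex_cnj_cnj mult_minus_left mult_minus_right mult_ac)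
      then show ?thesis
        unfolding \<omega>_sin_b sin_mult_cnj_cos by (simp add: args N_def diff_divide_distrib)
    qed
    also have "(- (sin \<phi> * cos (M * \<phi>)) * (D / 2) + 2 * sin (M * \<phi>) * (N / 2) = 0) \<longleftrightarrow>
        tan_eq_recip (M * \<phi>) (h_fun \<beta> n \<phi>)"
      unfolding h_fun_def D_def[symmetric] N_def[symmetric] tan_eq_recip_iff_mult[OF sin_pos \<open>D > 0\<close>]
      by (auto simp: field_simps)
    finally show ?thesis .
  qed
  finally show ?thesis by (simp add: M_def)
qed

end
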